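(* Let $d\ge 2$ and $n\ge 1$, let $T_n$ be the complete $d$-ary rooted tree of height $n$, and let $R_n$ denote the set of vertices of level $n$. Suppose that $G \leq \mathrm{Aut}(T_n)$ contains an element $\sigma$ acting on $R_n$ as a full $d^n$-cycle. If $d$ is a prime power then every nonempty $G$-block of $R_n$ is a basic block. If $d$ is prime then every nonempty $G$-block of $R_n$ is a single branch.
   Context: In the complete $d$-ary rooted tree $T_n$, level $0$ consists of the root, every vertex at level less than $n$ has exactly $d$ children at the next level, and $R_n$ (the top level) has $d^n$ vertices. $\mathrm{Aut}(T_n)$ is the group of automorphisms of $T_n$ as a rooted tree; it acts on $R_n$. For $0\le m\le n$ and a vertex $x$ of level $n-m$, the set of all vertices in $R_n$ that are descendants of $x$ (with $\{x\}$ itself if $m=0$) is called a branch of $R_n$, of height $m$; thus a branch of height $m$ has $d^m$ elements. For $G\le \mathrm{Aut}(T_n)$, a subset $E\subseteq R_n$ is a $G$-block if for every $g\in G$ the set $g(E)\cap E$ is equal to either $E$ or $\emptyset$. A $G$-block $E\subseteq R_n$ is a basic block if $E$ is either a single branch or a union of equal-height branches that are all contained in a single branch of height one more. *)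

theory Defs
  imports
    "HOL-Algebra.Bij"
    "HOL-Combinatorics.Orbits"
    "HOL-Library.Sublist"
    "HOL-Number_Theory.Prime_Powers"
begin

text \<open>
  A vertex of the complete \<open>d\<close>-ary rooted tree \<open>T\<^sub>n\<close> is encoded by the path leading to it from the
  root: the list of child indices (each less than \<open>d\<close>) chosen at the successive levels. The root is
  \<open>[]\<close>, the level of a vertex is its length, and \<open>y\<close> is a descendant of \<open>x\<close> (possibly \<open>x\<close> itself)
  iff \<open>x\<close> is a prefix of \<open>y\<close>.
\<close>

definition tree_level :: "nat \<Rightarrow> nat \<Rightarrow> nat list set" where
  "tree_level d l = {x. set x \<subseteq> {..<d} \<and> length x = l}"

definition tree_verts :: "nat \<Rightarrow> nat \<Rightarrow> nat list set" where
  "tree_verts d n = (\<Union>l\<le>n. tree_level d l)"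

definition is_child :: "nat list \<Rightarrow> nat list \<Rightarrow> bool" where
  "is_child y x \<longleftrightarrow> (\<exists>a. y = x @ [a])"

definition tree_adj :: "nat list \<Rightarrow> nat list \<Rightarrow> bool" where
  "tree_adj x y \<longleftrightarrow> is_child y x \<or> is_child x y"

text \<open>
  Rooted-tree automorphisms are the graph automorphisms fixing the root. As in
  \<open>HOL-Algebra.Bij\<close>, they are extensional functions (\<open>undefined\<close> off the vertex set),
  so that each automorphism is represented exactly once.
\<close>

definition tree_automorphisms :: "nat \<Rightarrow> nat \<Rightarrow> (nat list \<Rightarrow> nat list) set" where
  "tree_automorphisms d n =
    {f \<in> Bij (tree_verts d n). f [] = [] \<and>
       (\<forall>x\<in>tree_verts d n. \<forall>y\<in>tree_verts d n. tree_adj (f x) (f y) \<longleftrightarrow> tree_adj x y)}"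

definition Aut_tree :: "nat \<Rightarrow> nat \<Rightarrow> (nat list \<Rightarrow> nat list) monoid" where
  "Aut_tree d n = (BijGroup (tree_verts d n)) \<lparr>carrier := tree_automorphisms d n\<rparr>"

definition is_branch :: "nat \<Rightarrow> nat \<Rightarrow> nat \<Rightarrow> nat list set \<Rightarrow> bool" where
  "is_branch d n m B \<longleftrightarrow>
     m \<le> n \<and> (\<exists>x\<in>tree_level d (n - m). B = {y \<in> tree_level d n. prefix x y})"

definition is_block :: "nat \<Rightarrow> nat \<Rightarrow> (nat list \<Rightarrow> nat list) set \<Rightarrow> nat list set \<Rightarrow> bool" where
  "is_block d n G E \<longleftrightarrow>
     E \<subseteq> tree_level d n \<and> (\<forall>g\<in>G. g ` E \<inter> E = E \<or> g ` E \<inter> E = {})"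

definition is_basic_block ::
    "nat \<Rightarrow> nat \<Rightarrow> (nat list \<Rightarrow> nat list) set \<Rightarrow> nat list set \<Rightarrow> bool" where
  "is_basic_block d n G E \<longleftrightarrow> is_block d n G E \<and>
     ((\<exists>m. is_branch d n m E) \<or>
      (\<exists>m \<B> B. (\<forall>C\<in>\<B>. is_branch d n m C \<and> C \<subseteq> B) \<and> E = \<Union>\<B> \<and> is_branch d n (Suc m) B))"

lemma card_tree_level: "card (tree_level d l) = d ^ l"
  using card_lists_length_eq[of "{..<d}" l] by (simp add: tree_level_def)

lemma nil_in_tree_verts: "[] \<in> tree_verts d n"
  by (auto simp: tree_verts_def tree_level_def)

lemma subgroup_tree_automorphisms:
  "subgroup (tree_automorphisms d n) (BijGroup (tree_verts d n))"
proof (rule subgroup.intro)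
  let ?V = "tree_verts d n"
  show "tree_automorphisms d n \<subseteq> carrier (BijGroup ?V)"
    by (auto simp: tree_automorphisms_def BijGroup_def)
  show "\<one>\<^bsub>BijGroup ?V\<^esub> \<in> tree_automorphisms d n"
    by (auto simp: tree_automorphisms_def BijGroup_def id_Bij nil_in_tree_verts)
  fix f assume f: "f \<in> tree_automorphisms d n"
  then have fB: "f \<in> Bij ?V" and f0: "f [] = []"
    and fadj: "\<And>x y. x \<in> ?V \<Longrightarrow> y \<in> ?V \<Longrightarrow> tree_adj (f x) (f y) \<longleftrightarrow> tree_adj x y"
    by (auto simp: tree_automorphisms_def)
  {
    fix g assume "g \<in> tree_automorphisms d n"
    then show "f \<otimes>\<^bsub>BijGroup ?V\<^esub> g \<in> tree_automorphisms d n"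
      using f nil_in_tree_verts[of d n] Bij_imp_funcset[of g ?V]
      by (auto simp: tree_automorphisms_def BijGroup_def compose_Bij compose_eq Pi_iff)
  }
  let ?h = "inv_into ?V f"
  have bij: "bij_betw f ?V ?V" using fB by (simp add: Bij_def)
  have h: "?h x \<in> ?V" "f (?h x) = x" if "x \<in> ?V" for x
    using that bij by (auto simp: bij_betw_def inv_into_into f_inv_into_f)
  have h0: "?h [] = []"
    using bij f0 nil_in_tree_verts[of d n] by (metis bij_betw_inv_into_left)
  have "tree_adj (?h x) (?h y) \<longleftrightarrow> tree_adj x y" if "x \<in> ?V" "y \<in> ?V" for x y
    using fadj[of "?h x" "?h y"] h that by simp
  then show "inv\<^bsub>BijGroup ?V\<^esub> f \<in> tree_automorphisms d n"
    using fB h0 nil_in_tree_verts[of d n]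
    by (simp add: inv_BijGroup tree_automorphisms_def restrict_inv_into_Bij)
qed

lemma group_Aut_tree: "group (Aut_tree d n)"
  by (simp add: Aut_tree_def subgroup.subgroup_is_group subgroup_tree_automorphisms group_BijGroup)

end

(*
  Restricting to level-l prefixes turns the cycle on the leaves into a cycle of length d^l on
  level l, so its i-th power fixes the ancestor at level l of some leaf iff d^l divides i.
  The powers of the cycle that map a block into itself are exactly the multiples of a divisor s
  of d^n. If d = p^k, then s is a power of p, hence d^l | s | d^(l+1) for some l (unless s = d^n):
  the first divisibility puts the block inside one branch rooted at level l, the second one makes
  it a union of branches rooted at level l + 1. If d is prime, then s = d^l.
*)
theory Submission
  imports Defs
begin

section \<open>Periods of cyclic permutations and sets of multiples\<close>

lemma cyclic_on_funpow_fixed_iff: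
  assumes "cyclic_on f S" "x \<in> S"
  shows "(f ^^ i) x = x \<longleftrightarrow> card S dvd i"
proof -
  \<comment> \<open>\<open>D\<close> is the first return time to \<open>x\<close>. The iterates
    before it are distinct and exhaust the orbit, so \<open>D\<close> is the cycle length and
    \<open>i\<close> matters only modulo \<open>D\<close>.\<close>
  define D where "D = funpow_dist1 f x x"
  have S: "S = orbit f x" and x: "x \<in> orbit f x"
    using assms by (auto simp: cyclic_on_alldef)
  have inj: "inj_on (\<lambda>n. (f ^^ n) x) {0..<D}"
    unfolding D_def by (rule inj_on_funpow_dist1[OF x])
  have "card S = D"
    unfolding S orbit_conv_funpow_dist1[OF x] D_def[symmetric] using card_image[OF inj] by simp
  have "(f ^^ D) x = x"
    unfolding D_def by (rule funpow_dist1_prop[OF x])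
  then have "(f ^^ i) x = (f ^^ (i mod D)) x"
    by (simp add: funpow_mod_eq)
  moreover have "D > 0" by (simp add: D_def)
  then have "(f ^^ (i mod D)) x = (f ^^ 0) x \<longleftrightarrow> i mod D = 0"
    by (intro inj_on_eq_iff[OF inj]) auto
  ultimately show ?thesis
    using \<open>card S = D\<close> by (simp add: dvd_eq_mod_eq_0)
qed

text \<open>Division with remainder by the least positive solution, as for subgroups of the
  integers; the equivalence in \<open>add\<close> stands in for closure under subtraction. If no
  positive solution exists, \<open>s = 0\<close> works.\<close>

lemma multiples_of_least:
  fixes P :: "nat \<Rightarrow> bool"
  assumes P0: "P 0" and add: "\<And>i j. P i \<Longrightarrow> P (i + j) \<longleftrightarrow> P j"
  shows "\<exists>s. \<forall>i. P i \<longleftrightarrow> s dvd i"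
proof (cases "\<exists>i>0. P i")
  case False
  then show ?thesis using P0 by (intro exI[of _ 0]) auto
next
  case True
  define s where "s = (LEAST i. i > 0 \<and> P i)"
  have s: "s > 0" "P s" using LeastI_ex[OF True] by (auto simp: s_def)
  have mult: "P (s * q)" for q
    by (induction q) (use P0 add s in auto)
  have "P i \<longleftrightarrow> s dvd i" for i
  proof -
    have "P i \<longleftrightarrow> P (i mod s)"
      using add[OF mult[of "i div s"], of "i mod s"] by simp
    \<comment> \<open>The remainder is below \<open>s\<close>, so a positive remainder satisfying
      \<open>P\<close> would contradict minimality.\<close>
    also have "\<dots> \<longleftrightarrow> i mod s = 0"
      using P0 not_less_Least[of "i mod s" "\<lambda>i. i > 0 \<and> P i"] s by (auto simp: s_def[symmetric])
    finally show ?thesis by (simp add: dvd_eq_mod_eq_0)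
  qed
  then show ?thesis by blast
qed

section \<open>Truncation and branches\<close>

lemma finite_tree_level: "finite (tree_level d l)"
  using finite_lists_length_eq[of "{..<d}" l] by (simp add: tree_level_def)

lemma tree_verts_iff: "x \<in> tree_verts d n \<longleftrightarrow> set x \<subseteq> {..<d} \<and> length x \<le> n"
  by (auto simp: tree_verts_def tree_level_def)

lemma take_in_tree_level: "x \<in> tree_level d n \<Longrightarrow> l \<le> n \<Longrightarrow> take l x \<in> tree_level d l"
  by (auto simp: tree_level_def dest: in_set_takeD)

lemma take_image_tree_level:
  assumes "d > 0" "l \<le> n"
  shows "take l ` tree_level d n = tree_level d l"
proof
  show "tree_level d l \<subseteq> take l ` tree_level d n"
  proof
    fix x assume "x \<in> tree_level d l"
    then show "x \<in> take l ` tree_level d n"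
      \<comment> \<open>Padding with zeros reaches level \<open>n\<close>; the label 0 is legal
        because \<open>d > 0\<close>.\<close>
      using assms by (intro image_eqI[of _ _ "x @ replicate (n - l) 0"]) (auto simp: tree_level_def)
  qed
qed (use take_in_tree_level assms in blast)

text \<open>Turns fibres of truncation into branches. A fibre over level \<open>l\<close> has height
  \<open>n - l\<close>.\<close>

lemma is_branch_take:
  assumes "x \<in> tree_level d n" "l \<le> n"
  shows "is_branch d n (n - l) {y \<in> tree_level d n. take l y = take l x}"
proof -
  have "prefix u y \<longleftrightarrow> take (length u) y = u" for u y :: "nat list"
    by (metis append_eq_conv_conj prefixE take_is_prefix)
  moreover have "length (take l x) = l"
    using assms by (simp add: tree_level_def)
  ultimately have "{y \<in> tree_level d n. take l y = take l x} = {y \<in> tree_level d n. prefix (take l x) y}"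
    by simp
  then show ?thesis
    using take_in_tree_level[OF assms] assms(2) by (auto simp: is_branch_def)
qed

section \<open>Tree automorphisms commute with truncation\<close>

context
  fixes d n :: nat and f :: "nat list \<Rightarrow> nat list"
  assumes f: "f \<in> tree_automorphisms d n"
begin

text \<open>By induction on depth: the image of a child is adjacent to the image of its parent,
  hence is a child or the parent of that image. Injectivity rules out the second option, since by
  induction that parent is already the image of the grandparent; at the root no parent
  exists.\<close>

lemma automorphism_child:
  "x @ [a] \<in> tree_verts d n \<Longrightarrow> \<exists>b. f (x @ [a]) = f x @ [b]"
proof (induction x arbitrary: a rule: rev_induct)
  have bij: "bij_betw f (tree_verts d n) (tree_verts d n)" and f0: "f [] = []"
    and adj: "\<And>x y. x \<in> tree_verts d n \<Longrightarrow> y \<in> tree_verts d n \<Longrightarrow>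
      tree_adj (f x) (f y) \<longleftrightarrow> tree_adj x y"
    using f by (auto simp: tree_automorphisms_def Bij_def)
  {
    case Nil
    then have "tree_adj (f []) (f ([] @ [a]))"
      using adj[of "[]" "[a]"] nil_in_tree_verts by (auto simp: tree_adj_def is_child_def)
    then show ?case
      using f0 by (auto simp: tree_adj_def is_child_def)
  next
    case (snoc c x)
    have verts: "x \<in> tree_verts d n" "x @ [c] \<in> tree_verts d n"
      using snoc.prems by (auto simp: tree_verts_iff)
    obtain b where b: "f (x @ [c]) = f x @ [b]"
      using snoc.IH[OF verts(2)] by blast
    have "tree_adj (f (x @ [c])) (f ((x @ [c]) @ [a]))"
      using adj[OF verts(2) snoc.prems] by (auto simp: tree_adj_def is_child_def)
    moreover have "f ((x @ [c]) @ [a]) \<noteq> f x"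
      using bij_betw_imp_inj_on[OF bij] verts(1) snoc.prems by (auto dest: inj_onD)
    ultimately show ?case
      using b by (auto simp: tree_adj_def is_child_def)
  }
qed

lemma length_automorphism: "x \<in> tree_verts d n \<Longrightarrow> length (f x) = length x"
proof (induction x rule: rev_induct)
  case Nil
  then show ?case using f by (simp add: tree_automorphisms_def)
next
  case (snoc a x)
  then show ?case using automorphism_child[OF snoc.prems] by (auto simp: tree_verts_iff)
qed

lemma take_automorphism: "x \<in> tree_verts d n \<Longrightarrow> take l (f x) = f (take l x)"
proof (induction x rule: rev_induct)
  case Nil
  then show ?case using f by (simp add: tree_automorphisms_def)
next
  case (snoc a x)
  then have "x \<in> tree_verts d n" by (auto simp: tree_verts_iff)
  then show ?case
    using snoc.IH length_automorphism[of x] length_automorphism[OF snoc.prems]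
      automorphism_child[OF snoc.prems]
    \<comment> \<open>Either \<open>l\<close> cuts off the last entry and the induction hypothesis
      applies, or, lengths being preserved, both truncations change nothing.\<close>
    by (cases "l \<le> length x") auto
qed

end

text \<open>Elements of \<open>G\<close> are \<open>undefined\<close> off the vertex set, so
  \<open>\<sigma> ^^ i\<close> itself need not lie in \<open>G\<close>. Agreement on vertices
  suffices to apply the block condition to powers of \<open>\<sigma>\<close>.\<close>

lemma subgroup_Aut_tree_funpow:
  assumes G: "subgroup G (Aut_tree d n)" and \<sigma>: "\<sigma> \<in> G"
  shows "\<exists>g\<in>G. \<forall>x\<in>tree_verts d n. g x = (\<sigma> ^^ i) x"
proof (induction i)
  case 0
  show ?case
    using subgroup.one_closed[OF G]
    by (intro bexI[of _ "\<one>\<^bsub>Aut_tree d n\<^esub>"]) (auto simp: Aut_tree_def BijGroup_def)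
next
  case (Suc i)
  then obtain g where g: "g \<in> G" "\<forall>x\<in>tree_verts d n. g x = (\<sigma> ^^ i) x" by blast
  have "h \<in> Bij (tree_verts d n)" if "h \<in> G" for h
    using subgroup.subset[OF G] that by (auto simp: Aut_tree_def tree_automorphisms_def)
  with g(1) \<sigma> have "\<sigma> \<otimes>\<^bsub>Aut_tree d n\<^esub> g = compose (tree_verts d n) \<sigma> g"
    by (simp add: Aut_tree_def BijGroup_def)
  then show ?case
    using subgroup.m_closed[OF G \<sigma> g(1)] g(2)
    by (intro bexI[of _ "\<sigma> \<otimes>\<^bsub>Aut_tree d n\<^esub> g"]) (auto simp: compose_eq)
qed

section \<open>Action of the cycle on levels and blocks\<close>

context
  fixes d n :: nat and G :: "(nat list \<Rightarrow> nat list) set" and \<sigma> :: "nat list \<Rightarrow> nat list"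
  assumes d: "d > 0"
    and G: "subgroup G (Aut_tree d n)"
    and \<sigma>: "\<sigma> \<in> G" and cyc: "cyclic_on \<sigma> (tree_level d n)"
begin

lemma take_funpow_eq_iff:
  assumes y: "y \<in> tree_level d n" and l: "l \<le> n"
  shows "take l ((\<sigma> ^^ i) y) = take l y \<longleftrightarrow> d ^ l dvd i"
proof -
  have "\<sigma> \<in> tree_automorphisms d n"
    using subgroup.subset[OF G] \<sigma> by (auto simp: Aut_tree_def)
  then have tk: "\<sigma> (take l x) = take l (\<sigma> x)" if "x \<in> tree_level d n" for x
    using take_automorphism[of \<sigma> d n x l] that by (simp add: tree_verts_iff tree_level_def)
  \<comment> \<open>Truncation maps level \<open>n\<close> onto level \<open>l\<close> and commutes
    with \<open>\<sigma>\<close>, so it carries the cycle to a cycle.\<close>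
  then have cyc_l: "cyclic_on \<sigma> (tree_level d l)"
    using cyclic_on_image[OF cyc, of \<sigma> "take l"] take_image_tree_level[OF d l] by simp
  have "take l ((\<sigma> ^^ i) y) = (\<sigma> ^^ i) (take l y)"
    by (induction i) (simp_all add: tk[OF cyclic_on_funpow_in[OF cyc y], symmetric])
  then show ?thesis
    using cyclic_on_funpow_fixed_iff[OF cyc_l take_in_tree_level[OF y l]]
    by (simp add: card_tree_level)
qed

lemma funpow_transitive:
  assumes "x \<in> tree_level d n" "y \<in> tree_level d n"
  obtains i where "y = (\<sigma> ^^ i) x"
proof -
  have "y \<in> orbit \<sigma> x"
    using orbit_cyclic_eq3[OF cyc assms(1)] assms(2) by simp
  then show thesis
    using that unfolding orbit_altdef by blast
qed

text \<open>For a block, sending one point of \<open>E\<close> into \<open>E\<close> already means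
  stabilizing \<open>E\<close>. The exponents that do so are therefore the same for all points, and
  they are the multiples of some \<open>s\<close>.\<close>

lemma block_period:
  assumes E: "is_block d n G E" and ne: "E \<noteq> {}"
  obtains s where "s dvd d ^ n" "\<And>i y. y \<in> E \<Longrightarrow> (\<sigma> ^^ i) y \<in> E \<longleftrightarrow> s dvd i"
proof -
  have sub: "E \<subseteq> tree_level d n" using E by (simp add: is_block_def)
  have finE: "finite E" using sub finite_tree_level finite_subset by blast
  have iff: "(\<sigma> ^^ i) ` E = E \<longleftrightarrow> (\<sigma> ^^ i) y \<in> E" if "y \<in> E" for i y
  proof
    assume "(\<sigma> ^^ i) y \<in> E"
    obtain g where g: "g \<in> G" "\<forall>x\<in>tree_verts d n. g x = (\<sigma> ^^ i) x"
      using subgroup_Aut_tree_funpow[OF G \<sigma>] by blast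
    have "g ` E = (\<sigma> ^^ i) ` E"
      using g(2) sub by (intro image_cong) (auto simp: tree_verts_def)
    moreover have "g ` E \<inter> E = E \<or> g ` E \<inter> E = {}"
      using E g(1) by (simp add: is_block_def)
    \<comment> \<open>The image meets \<open>E\<close>, so the block condition leaves only
      containment; finiteness then upgrades it to equality.\<close>
    ultimately have "E \<subseteq> (\<sigma> ^^ i) ` E"
      using \<open>(\<sigma> ^^ i) y \<in> E\<close> \<open>y \<in> E\<close> by blast
    then show "(\<sigma> ^^ i) ` E = E"
      using card_seteq[OF finite_imageI[OF finE]] card_image_le[OF finE] by metis
  qed (use that in blast)
  have "\<exists>s. \<forall>i. (\<sigma> ^^ i) ` E = E \<longleftrightarrow> s dvd i"
  proof (rule multiples_of_least)
    fix i j assume "(\<sigma> ^^ i) ` E = E"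
    moreover have "(\<sigma> ^^ (i + j)) ` E = (\<sigma> ^^ j) ` ((\<sigma> ^^ i) ` E)"
      using funpow_add[of j i \<sigma>] by (simp add: image_comp add.commute)
    ultimately show "(\<sigma> ^^ (i + j)) ` E = E \<longleftrightarrow> (\<sigma> ^^ j) ` E = E"
      by simp
  qed simp
  then obtain s where s: "\<And>i. (\<sigma> ^^ i) ` E = E \<longleftrightarrow> s dvd i" by blast
  obtain e where e: "e \<in> E" using ne by blast
  \<comment> \<open>The full cycle has length \<open>d ^ n\<close>, so this power returns
    \<open>e\<close> to \<open>E\<close> and \<open>s\<close> divides \<open>d ^ n\<close>.\<close>
  have "(\<sigma> ^^ (d ^ n)) e = e"
    using cyclic_on_funpow_fixed_iff[OF cyc, of e] e sub by (auto simp: card_tree_level)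
  then have "s dvd d ^ n" using e iff[OF e] s by metis
  then show thesis using that iff s by metis
qed

text \<open>Every point of \<open>E\<close> is \<open>(\<sigma> ^^ i) e\<close> with
  \<open>s dvd i\<close>, hence \<open>d ^ l dvd i\<close>, and such a power fixes the ancestor of
  \<open>e\<close> at level \<open>l\<close>.\<close>

lemma block_subset_branch:
  assumes E: "E \<subseteq> tree_level d n" "\<And>i y. y \<in> E \<Longrightarrow> (\<sigma> ^^ i) y \<in> E \<longleftrightarrow> s dvd i"
    and e: "e \<in> E" and l: "l \<le> n" "d ^ l dvd s"
  shows "E \<subseteq> {y \<in> tree_level d n. take l y = take l e}"
proof
  fix y assume "y \<in> E"
  obtain i where i: "y = (\<sigma> ^^ i) e"
    using funpow_transitive[of e y] e \<open>y \<in> E\<close> E(1) by blast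
  then have "d ^ l dvd i" using E(2)[OF e, of i] \<open>y \<in> E\<close> l(2) dvd_trans by blast
  then show "y \<in> {y \<in> tree_level d n. take l y = take l e}"
    using take_funpow_eq_iff[of e l i] i e \<open>y \<in> E\<close> E(1) l(1) by blast
qed

text \<open>The converse direction: a leaf with the same ancestor at level \<open>l\<close> is
  reached by an exponent divisible by \<open>d ^ l\<close>, hence by \<open>s\<close>.\<close>

lemma branch_subset_block:
  assumes E: "E \<subseteq> tree_level d n" "\<And>i y. y \<in> E \<Longrightarrow> (\<sigma> ^^ i) y \<in> E \<longleftrightarrow> s dvd i"
    and e: "e \<in> E" and l: "l \<le> n" "s dvd d ^ l"
  shows "{y \<in> tree_level d n. take l y = take l e} \<subseteq> E"
proof
  fix y assume y: "y \<in> {y \<in> tree_level d n. take l y = take l e}"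
  obtain i where i: "y = (\<sigma> ^^ i) e"
    using funpow_transitive[of e y] e y E(1) by blast
  then have "d ^ l dvd i" using take_funpow_eq_iff[of e l i] y e E(1) l(1) by blast
  then show "y \<in> E" using E(2)[OF e, of i] i l(2) dvd_trans by blast
qed

lemma block_is_branch:
  assumes E: "E \<subseteq> tree_level d n" "\<And>i y. y \<in> E \<Longrightarrow> (\<sigma> ^^ i) y \<in> E \<longleftrightarrow> d ^ l dvd i"
    and e: "e \<in> E" and l: "l \<le> n"
  shows "is_branch d n (n - l) E"
proof -
  have "E = {y \<in> tree_level d n. take l y = take l e}"
    using block_subset_branch[OF E e l dvd_refl] branch_subset_block[OF E e l dvd_refl]
    by (rule subset_antisym)
  then show ?thesis using is_branch_take[of e d n l] e E(1) l by auto
qed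

section \<open>Blocks in prime and prime power degree\<close>

lemma prime_block_is_branch:
  assumes "prime d" and E: "is_block d n G E" "E \<noteq> {}"
  shows "\<exists>m. is_branch d n m E"
proof -
  obtain s where s: "s dvd d ^ n" "\<And>i y. y \<in> E \<Longrightarrow> (\<sigma> ^^ i) y \<in> E \<longleftrightarrow> s dvd i"
    using block_period[OF E] by blast
  obtain l where "l \<le> n" "s = d ^ l"
    using s(1) divides_primepow_nat[OF \<open>prime d\<close>] by blast
  then show ?thesis
    using block_is_branch[of E l] s(2) E by (auto simp: is_block_def)
qed

lemma primepow_block_is_basic:
  assumes "primepow d" and E: "is_block d n G E" "E \<noteq> {}"
  shows "is_basic_block d n G E"
proof -
  obtain s where s: "s dvd d ^ n" "\<And>i y. y \<in> E \<Longrightarrow> (\<sigma> ^^ i) y \<in> E \<longleftrightarrow> s dvd i"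
    using block_period[OF E] by blast
  obtain e where e: "e \<in> E" using E(2) by blast
  have sub: "E \<subseteq> tree_level d n" using E(1) by (simp add: is_block_def)
  obtain p k where p: "prime p" "k > 0" "d = p ^ k"
    using \<open>primepow d\<close> by (auto simp: primepow_def)
  obtain t where t: "t \<le> k * n" "s = p ^ t"
    using s(1) divides_primepow_nat[OF p(1), of s "k * n"] unfolding p(3) power_mult[symmetric]
    by blast
  \<comment> \<open>Chosen so that \<open>k * l \<le> t < k * Suc l\<close>, which for powers of
    \<open>p\<close> says that \<open>s\<close> lies between \<open>d ^ l\<close> and
    \<open>d ^ Suc l\<close> in divisibility.\<close>
  define l where "l = t div k"
  have "l \<le> n" using div_le_mono[OF t(1), of k] p(2) by (simp add: l_def)
  have "k * l \<le> t" by (simp add: l_def)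
  then have lower: "d ^ l dvd s"
    by (simp add: t(2) p(3) power_mult[symmetric] le_imp_power_dvd)
  have "t < k * Suc l"
    using p(2) by (simp add: l_def dividend_less_times_div)
  then have upper: "s dvd d ^ Suc l"
    unfolding t(2) p(3) power_mult[symmetric] by (intro le_imp_power_dvd) simp
  show ?thesis
  proof (cases "l = n")
    \<comment> \<open>There is no level \<open>Suc n\<close>; here \<open>s = d ^ n\<close> and the
      block is a single leaf.\<close>
    case True
    then have "s = d ^ n" using s(1) lower by (simp add: dvd_antisym)
    then have "is_branch d n (n - n) E" using s(2) sub e by (intro block_is_branch) auto
    then show ?thesis using E(1) unfolding is_basic_block_def by blast
  next
    case False
    with \<open>l \<le> n\<close> have "Suc l \<le> n" by simp
    define B where "B = {y \<in> tree_level d n. take l y = take l e}"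
    \<comment> \<open>\<open>C x\<close> is the branch through \<open>x\<close> rooted one level
      below the root of \<open>B\<close>. The branches through the points of \<open>E\<close> make
      up \<open>E\<close>.\<close>
    define C where "C x = {y \<in> tree_level d n. take (Suc l) y = take (Suc l) x}" for x
    have "E \<subseteq> B"
      unfolding B_def by (rule block_subset_branch[OF sub s(2) e \<open>l \<le> n\<close> lower])
    moreover have CE: "C x \<subseteq> E" if "x \<in> E" for x
      unfolding C_def by (rule branch_subset_block[OF sub s(2) that \<open>Suc l \<le> n\<close> upper])
    moreover have "E = \<Union>(C ` E)" using CE sub by (auto simp: C_def)
    moreover have "is_branch d n (n - Suc l) (C x)" if "x \<in> E" for x
      using that sub \<open>Suc l \<le> n\<close> unfolding C_def by (intro is_branch_take) auto
    moreover have "is_branch d n (Suc (n - Suc l)) B"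
      using is_branch_take[of e d n l] e sub \<open>Suc l \<le> n\<close> by (auto simp: B_def Suc_diff_Suc)
    ultimately have "(\<forall>A\<in>C ` E. is_branch d n (n - Suc l) A \<and> A \<subseteq> B) \<and> E = \<Union>(C ` E) \<and>
        is_branch d n (Suc (n - Suc l)) B"
      by blast
    then have "\<exists>m \<B> B. (\<forall>A\<in>\<B>. is_branch d n m A \<and> A \<subseteq> B) \<and> E = \<Union>\<B> \<and> is_branch d n (Suc m) B"
      by (intro exI[of _ "n - Suc l"] exI[of _ "C ` E"] exI[of _ B])
    then show ?thesis using E(1) by (simp add: is_basic_block_def)
  qed
qed

end

theorem theorem4p1:
  fixes d n :: nat and G :: "(nat list \<Rightarrow> nat list) set" and \<sigma> :: "nat list \<Rightarrow> nat list"
  assumes "d \<ge> 2" and "n \<ge> 1"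
    and "subgroup G (Aut_tree d n)"
    and "\<sigma> \<in> G" and "cyclic_on \<sigma> (tree_level d n)"
  shows "(primepow d \<longrightarrow> (\<forall>E. is_block d n G E \<and> E \<noteq> {} \<longrightarrow> is_basic_block d n G E))
       \<and> (prime d \<longrightarrow> (\<forall>E. is_block d n G E \<and> E \<noteq> {} \<longrightarrow> (\<exists>m. is_branch d n m E)))"
proof -
  have "d > 0" using assms(1) by simp
  then show ?thesis
    using primepow_block_is_basic[OF _ assms(3-5)] prime_block_is_branch[OF _ assms(3-5)] by blast
qed

end
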